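(* Let $\mathbf Q \in \mathbb C^{m \times n}$ with $n < m$ be subunitary. Let $\mathbf z \in \mathbb C^m$ be such that $\mathbf z \not\in \operatorname{Range}(\mathbf Q)$. Then $\delta = \frac{1}{\|\mathbf z\|}$ minimizes $\kappa_2\left(\begin{bmatrix}\mathbf Q & \delta \mathbf z\end{bmatrix}\right)$ over all $\delta \in \mathbb R$.
   Context: A matrix $\mathbf Q\in\mathbb C^{m\times n}$ is called subunitary if its columns are orthonormal, i.e. $\mathbf Q^*\mathbf Q=\mathbf I_n$, where $^*$ denotes conjugate transpose. Here $n\ge 1$, $\|\cdot\|$ is the Euclidean norm, and $\begin{bmatrix}\mathbf Q & \delta\mathbf z\end{bmatrix}\in\mathbb C^{m\times(n+1)}$ is $\mathbf Q$ with the extra column $\delta\mathbf z$ appended. $\kappa_2$ is the 2-norm condition number: the ratio of the largest to the smallest of the $n+1$ singular values, with the usual convention that $\kappa_2=+\infty$ for a matrix without full column rank (as happens here for $\delta=0$). *)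

theory Defs
  imports
    "Jordan_Normal_Form.DL_Rank"
    "Jordan_Normal_Form.Schur_Decomposition"
    "HOL-Library.Extended_Real"
begin

definition subunitary :: "complex mat \<Rightarrow> bool" where
  "subunitary Q \<longleftrightarrow> mat_adjoint Q * Q = 1\<^sub>m (dim_col Q)"

definition euclidean_norm :: "complex vec \<Rightarrow> real" where
  "euclidean_norm v = sqrt (\<Sum>i<dim_vec v. (cmod (v $ i))\<^sup>2)"

definition append_column :: "'a mat \<Rightarrow> 'a vec \<Rightarrow> 'a mat" where
  "append_column A v = mat_of_cols (dim_row A) (cols A @ [v])"

text \<open>The nonnegative square roots of the eigenvalues of \<open>A\<^sup>* A\<close>, without multiplicities.
  If \<open>A\<close> has at least as many rows as columns, these are exactly the values taken by its
  \<open>dim_col A\<close> singular values.  (With more columns than rows, the set also contains a \<open>0\<close> that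
  need not be a singular value; such a matrix has no full column rank, and the definition of
  \<open>cond2\<close> does not use the set then.)\<close>

definition singular_values :: "complex mat \<Rightarrow> real set" where
  "singular_values A =
    {\<sigma>. 0 \<le> \<sigma> \<and> eigenvalue (mat_adjoint A * A) (complex_of_real (\<sigma>\<^sup>2))}"

definition full_column_rank :: "complex mat \<Rightarrow> bool" where
  "full_column_rank A \<longleftrightarrow> vec_space.rank (dim_row A) A = dim_col A"

text \<open>The 2-norm condition number; it is meant for matrices with at least one column.\<close>

definition cond2 :: "complex mat \<Rightarrow> ereal" where
  "cond2 A =
    (if full_column_rank A then ereal (Max (singular_values A) / Min (singular_values A))
     else \<infinity>)"

end

theory Submission
  imports Defs
begin

text \<open>Write \<open>w = Q\<^sup>* z\<close>, \<open>s = \<parallel>z\<parallel>\<^sup>2\<close>, \<open>W = \<parallel>w\<parallel>\<^sup>2\<close> and \<open>B\<close> for \<open>Q\<close> with the extra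
  column \<open>\<delta> z\<close>.  Since \<open>Q\<^sup>* Q\<close> is the identity, the Gram matrix \<open>B\<^sup>* B\<close> is the arrow matrix with
  blocks \<open>I\<close>, \<open>\<delta> w\<close>, \<open>\<delta> w\<^sup>*\<close>, \<open>\<delta>\<^sup>2 s\<close>.  Eliminating the first \<open>n\<close> coordinates of an eigenvector shows
  that every eigenvalue is either \<open>1\<close> or a root of
  \<open>(t - 1) (t - \<delta>\<^sup>2 s) = \<delta>\<^sup>2 W\<close>,
  and for \<open>\<delta> \<noteq> 0\<close> both roots \<open>l \<le> u\<close> are eigenvalues (\<open>gram_eigenvalueD\<close>, \<open>gram_eigenvalueI\<close>).
  The left-hand side minus the right-hand side is \<open>- \<delta>\<^sup>2 W \<le> 0\<close> at \<open>t = 1\<close>, so \<open>l \<le> 1 \<le> u\<close>: the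
  eigenvalue \<open>1\<close> is never extreme, and the condition number is \<open>sqrt (u / l)\<close> (\<open>cond2_B\<close>).

  The vector \<open>z\<close> lies outside the range of \<open>Q\<close>, so it is not its own orthogonal projection
  \<open>Q w\<close>, and therefore \<open>W < s\<close> (\<open>W_less_s\<close>).  Hence \<open>l u = \<delta>\<^sup>2 (s - W)\<close> is positive.  As \<open>u / l \<ge> 1\<close>
  grows with
  \<open>(l + u)\<^sup>2 / (l u) = (1 + \<delta>\<^sup>2 s)\<^sup>2 / (\<delta>\<^sup>2 (s - W))\<close>
  (\<open>quotient_le_of_sum_product\<close>), and \<open>(1 + x)\<^sup>2 \<ge> 4 x\<close> with equality at \<open>x = 1\<close>, the minimum is
  attained where \<open>\<delta>\<^sup>2 s = 1\<close>.  At \<open>\<delta> = 0\<close> the zero column destroys the full column rank and the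
  condition number is infinite.\<close>

section \<open>Full column rank as injectivity\<close>

text \<open>The rank counts the largest independent subset of the \<^emph>\<open>set\<close> of columns.  Repeated columns
  must therefore be excluded before independence of that set says anything about the kernel of
  the matrix: full rank rules them out by counting, a trivial kernel because two equal columns
  \<open>i\<close>, \<open>j\<close> put the difference of the unit vectors \<open>i\<close> and \<open>j\<close> into it.\<close>

lemma full_column_rank_iff_injective:
  assumes A: "A \<in> carrier_mat m n"
  shows "full_column_rank A \<longleftrightarrow> (\<forall>v\<in>carrier_vec n. A *\<^sub>v v = 0\<^sub>v m \<longrightarrow> v = 0\<^sub>v n)"
proof
  interpret vec_space "TYPE(complex)" m .
  assume "full_column_rank A"
  then have rank: "rank A = n"
    using A by (auto simp: full_column_rank_def)
  have dist: "distinct (cols A)"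
  proof -
    have "\<exists>S. maximal S (\<lambda>T. T \<subseteq> set (cols A) \<and> lin_indpt T)"
      using maximal_exists[of "(\<lambda>T. T \<subseteq> set (cols A) \<and> lin_indpt T)" "card (set (cols A))" "{}"]
      by (meson List.finite_set card_mono empty_iff empty_subsetI finite_lin_indpt2 rev_finite_subset)
    then obtain S where S: "maximal S (\<lambda>T. T \<subseteq> set (cols A) \<and> lin_indpt T)" ..
    have "n = card S"
      using rank_card_indpt[OF A S] rank by simp
    also have "\<dots> \<le> card (set (cols A))"
      using S by (intro card_mono) (auto simp: maximal_def)
    finally show ?thesis
      using A card_length[of "cols A"] by (intro card_distinct) auto
  qed
  show "\<forall>v\<in>carrier_vec n. A *\<^sub>v v = 0\<^sub>v m \<longrightarrow> v = 0\<^sub>v n"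
    using lin_depI[OF A _ _ _ dist] full_rank_lin_indpt[OF A rank dist] by blast
next
  interpret vec_space "TYPE(complex)" m .
  assume inj: "\<forall>v\<in>carrier_vec n. A *\<^sub>v v = 0\<^sub>v m \<longrightarrow> v = 0\<^sub>v n"
  have dist: "distinct (cols A)"
  proof (rule ccontr)
    assume "\<not> distinct (cols A)"
    then obtain i j where ij: "i < n" "j < n" "i \<noteq> j" "col A i = col A j"
      using A by (auto simp: distinct_conv_nth)
    let ?v = "unit_vec n i - unit_vec n j :: complex vec"
    have "A *\<^sub>v ?v = A *\<^sub>v unit_vec n i - A *\<^sub>v unit_vec n j"
      using A by (intro mult_minus_distrib_mat_vec) auto
    also have "\<dots> = col A i - col A j"
      using A ij(1,2) by (intro arg_cong2[where f = "(-)"] eq_vecI) auto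
    also have "\<dots> = 0\<^sub>v m"
      using A ij by auto
    finally have "?v = 0\<^sub>v n" using inj by auto
    then have "?v $ i = 0" using ij by simp
    then show False using ij by simp
  qed
  have "lin_indpt (set (cols A))"
    using lin_depE[OF A _ dist] inj by blast
  then show "full_column_rank A"
    using lin_indpt_full_rank[OF A dist] A by (auto simp: full_column_rank_def)
qed

section \<open>Adjoints and appended columns\<close>

lemma index_mat_adjoint_mult_vec:
  assumes "A \<in> carrier_mat m n" "u \<in> carrier_vec m" "i < n"
  shows "(mat_adjoint A *\<^sub>v u) $ i = u \<bullet>c col A i"
  using assms by (auto simp: mat_adjoint_def conjugate_vec_def scalar_prod_def intro!: sum.cong)

lemma mat_adjoint_carrier:
  "A \<in> carrier_mat m n \<Longrightarrow> mat_adjoint A \<in> carrier_mat n m"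
  by (auto simp: mat_adjoint_def)

lemma cscalar_prod_mat_adjoint:
  fixes A :: "complex mat"
  assumes A: "A \<in> carrier_mat m n" and y: "y \<in> carrier_vec n" and u: "u \<in> carrier_vec m"
  shows "(A *\<^sub>v y) \<bullet>c u = y \<bullet>c (mat_adjoint A *\<^sub>v u)"
proof -
  have "(A *\<^sub>v y) \<bullet>c u = (\<Sum>i<m. \<Sum>j<n. A $$ (i,j) * y $ j * cnj (u $ i))"
    using assms by (auto simp: scalar_prod_def sum_distrib_right lessThan_atLeast0 intro!: sum.cong)
  also have "\<dots> = (\<Sum>j<n. \<Sum>i<m. A $$ (i,j) * y $ j * cnj (u $ i))"
    by (rule sum.swap)
  also have "\<dots> = (\<Sum>j<n. y $ j * cnj (u \<bullet>c col A j))"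
    using assms by (auto simp: scalar_prod_def sum_distrib_left lessThan_atLeast0 intro!: sum.cong)
  also have "\<dots> = (\<Sum>j<n. y $ j * cnj ((mat_adjoint A *\<^sub>v u) $ j))"
    using assms by (intro sum.cong) (auto simp: index_mat_adjoint_mult_vec[OF A u])
  also have "\<dots> = y \<bullet>c (mat_adjoint A *\<^sub>v u)"
    using A mat_adjoint_carrier[OF A] by (auto simp: scalar_prod_def lessThan_atLeast0)
  finally show ?thesis .
qed

lemma cscalar_prod_self:
  "v \<bullet>c v = complex_of_real ((euclidean_norm v)\<^sup>2)"
proof -
  have "v \<bullet>c v = complex_of_real (\<Sum>i<dim_vec v. (cmod (v $ i))\<^sup>2)"
    by (auto simp: scalar_prod_def lessThan_atLeast0 complex_norm_square simp del: of_real_power intro!: sum.cong)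
  then show ?thesis
    by (simp add: euclidean_norm_def sum_nonneg)
qed

text \<open>Vectors on which a matrix with an appended column acts are split into the part seen by the
  original columns and the last coordinate.\<close>

definition snoc_vec :: "'a vec \<Rightarrow> 'a \<Rightarrow> 'a vec" where
  "snoc_vec y a = y @\<^sub>v vec 1 (\<lambda>_. a)"

lemma dim_snoc_vec [simp]: "dim_vec (snoc_vec y a) = Suc (dim_vec y)"
  by (simp add: snoc_vec_def)

lemma snoc_vec_carrier: "y \<in> carrier_vec n \<Longrightarrow> snoc_vec y a \<in> carrier_vec (Suc n)"
  by (auto intro: carrier_vecI)

lemma index_snoc_vec [simp]:
  "i < Suc (dim_vec y) \<Longrightarrow> snoc_vec y a $ i = (if i < dim_vec y then y $ i else a)"
  by (auto simp: snoc_vec_def)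

lemma snoc_vec_eq_iff:
  assumes "y \<in> carrier_vec n" "y' \<in> carrier_vec n"
  shows "snoc_vec y a = snoc_vec y' b \<longleftrightarrow> y = y' \<and> a = b"
proof -
  have "vec 1 (\<lambda>_. a) = vec 1 (\<lambda>_. b) \<longleftrightarrow> a = b"
    by (auto simp: vec_eq_iff)
  then show ?thesis
    using append_vec_eq[OF assms] by (simp add: snoc_vec_def)
qed

lemma zero_vec_Suc_eq_snoc: "0\<^sub>v (Suc n) = snoc_vec (0\<^sub>v n) 0"
  by (rule eq_vecI) auto

lemma smult_snoc_vec: "c \<cdot>\<^sub>v snoc_vec y a = snoc_vec (c \<cdot>\<^sub>v y) (c * a)"
  by (rule eq_vecI) auto

lemma vec_Suc_cases:
  assumes "v \<in> carrier_vec (Suc n)"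
  obtains y a where "y \<in> carrier_vec n" "v = snoc_vec y a"
proof
  show "v = snoc_vec (vec n (($) v)) (v $ n)"
    using assms by (intro eq_vecI) (auto simp: less_Suc_eq)
qed auto

lemma append_column_carrier:
  "A \<in> carrier_mat m n \<Longrightarrow> append_column A v \<in> carrier_mat m (Suc n)"
  by (auto simp: append_column_def)

lemma col_append_column:
  assumes "A \<in> carrier_mat m n" "v \<in> carrier_vec m" "j < Suc n"
  shows "col (append_column A v) j = (if j < n then col A j else v)"
  using assms unfolding append_column_def 
  by (subst col_mat_of_cols) (auto simp: nth_append less_Suc_eq)

lemma append_column_mult_vec:
  fixes A :: "'a::comm_ring_1 mat"
  assumes A: "A \<in> carrier_mat m n" and v: "v \<in> carrier_vec m" and y: "y \<in> carrier_vec n"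
  shows "append_column A v *\<^sub>v snoc_vec y a = A *\<^sub>v y + a \<cdot>\<^sub>v v"
proof (rule eq_vecI)
  let ?B = "append_column A v"
  have B: "?B \<in> carrier_mat m (Suc n)"
    using A by (rule append_column_carrier)
  have entry: "?B $$ (i,j) = (if j < n then A $$ (i,j) else v $ i)" if "i < m" "j < Suc n" for i j
    using col_append_column[OF A v that(2)] that A B 
    by (metis (no_types, lifting) carrier_matD index_col)
  fix i assume "i < dim_vec (A *\<^sub>v y + a \<cdot>\<^sub>v v)"
  then have i: "i < m" using v by simp
  show "(?B *\<^sub>v snoc_vec y a) $ i = (A *\<^sub>v y + a \<cdot>\<^sub>v v) $ i"
    using i A B v y by (simp add: scalar_prod_def entry)
qed (use A v in \<open>auto simp: append_column_def\<close>)

lemma mat_adjoint_append_column_mult_vec: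
  fixes A :: "complex mat"
  assumes A: "A \<in> carrier_mat m n" and v: "v \<in> carrier_vec m" and u: "u \<in> carrier_vec m"
  shows "mat_adjoint (append_column A v) *\<^sub>v u = snoc_vec (mat_adjoint A *\<^sub>v u) (u \<bullet>c v)"
    (is "?l = ?r")
proof (rule eq_vecI)
  have B: "append_column A v \<in> carrier_mat m (Suc n)"
    using A by (rule append_column_carrier)
  note adj = mat_adjoint_carrier[OF A] mat_adjoint_carrier[OF B]
  show "dim_vec ?l = dim_vec ?r" using adj by simp
  fix i assume "i < dim_vec ?r"
  then have i: "i < Suc n" using adj by simp
  show "?l $ i = ?r $ i"
    unfolding index_mat_adjoint_mult_vec[OF B u i] col_append_column[OF A v i]
    using i adj index_mat_adjoint_mult_vec[OF A u] by (auto simp: less_Suc_eq simp del: index_mult_mat_vec)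
qed

section \<open>Extreme values and the roots of a quadratic\<close>

text \<open>The set may or may not contain \<open>c\<close>.  This covers the singular value \<open>1\<close>, which can be absent
  when \<open>n = 1\<close> but never affects the extremes.\<close>

lemma Max_Min_sandwich:
  fixes S :: "'a::linorder set"
  assumes "{l, u} \<subseteq> S" "S \<subseteq> {l, c, u}" "l \<le> c" "c \<le> u"
  shows "Max S = u" "Min S = l"
proof -
  have fin: "finite S" using assms(2) finite_subset by blast
  have bounds: "l \<le> x \<and> x \<le> u" if "x \<in> S" for x
  proof -
    have "x = l \<or> x = c \<or> x = u" using that assms(2) by blast
    then show ?thesis using assms(3,4) by (elim disjE) auto
  qed
  show "Max S = u" using fin bounds assms(1) by (intro Max_eqI) blast+
  show "Min S = l" using fin bounds assms(1) by (intro Min_eqI) blast+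
qed

text \<open>With \<open>x = u / l\<close> we have \<open>(l + u)\<^sup>2 / (l u) = x + 1 / x + 2\<close>, which is strictly increasing for
  \<open>x \<ge> 1\<close>.  Cleared of denominators, the difference of the two sides of the last premise factors.\<close>

lemma quotient_le_of_sum_product:
  fixes l u l' u' :: real
  assumes pos: "0 < l" "l \<le> u" "0 < l'" "l' \<le> u'"
    and le: "(l + u)\<^sup>2 * (l' * u') \<le> (l' + u')\<^sup>2 * (l * u)"
  shows "u / l \<le> u' / l'"
proof (rule ccontr)
  assume "\<not> ?thesis"
  moreover have "u / l \<le> u' / l' \<longleftrightarrow> u * l' \<le> u' * l"
    using pos(1,3) by (simp add: pos_divide_le_eq pos_le_divide_eq)
  ultimately have *: "u' * l < u * l'"
    by (simp only: not_le)
  have "l * l' \<le> u' * l"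
    using mult_right_mono[of l' u' l] pos by (simp add: mult.commute)
  also note *
  also have "u * l' \<le> u * u'"
    using mult_left_mono[of l' u' u] pos by simp
  finally have "(u * l' - u' * l) * (u * u' - l * l') > 0"
    using * by (intro mult_pos_pos) simp_all
  also have "(u * l' - u' * l) * (u * u' - l * l') = (l + u)\<^sup>2 * (l' * u') - (l' + u')\<^sup>2 * (l * u)"
    by (simp add: power2_eq_square algebra_simps)
  finally show False using le by linarith
qed

text \<open>The polynomial has the value \<open>- q \<le> 0\<close> at \<open>1\<close> and \<open>b - q > 0\<close> at \<open>0\<close>, so its roots are real,
  positive, and separated by \<open>1\<close>.\<close>

lemma quadratic_roots:
  fixes q b :: real
  assumes "0 \<le> q" "q < b"
  obtains l u where "0 < l" "l \<le> 1" "1 \<le> u" "l + u = 1 + b" "l * u = b - q"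
    "\<forall>t. (t - 1) * (t - b) - q = (t - l) * (t - u)"
proof -
  define D where "D = sqrt ((b - 1)\<^sup>2 + 4 * q)"
  have D2: "D * D = (b - 1)\<^sup>2 + 4 * q"
    using assms by (simp add: D_def)
  have D: "\<bar>b - 1\<bar> \<le> D"
    unfolding D_def by (rule real_le_rsqrt) (use assms in simp)
  have "D < 1 + b"
    unfolding D_def by (rule real_less_lsqrt) (use assms in \<open>auto simp: power2_eq_square algebra_simps\<close>)
  show ?thesis
  proof (rule that[of "(1 + b - D) / 2" "(1 + b + D) / 2"])
    show "(1 + b - D) / 2 * ((1 + b + D) / 2) = b - q"
    proof -
      have "(1 + b - D) * (1 + b + D) = 4 * (b - q)"
      proof -
        have "(1 + b - D) * (1 + b + D) = (1 + b)\<^sup>2 - D * D"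
          by (simp add: power2_eq_square algebra_simps)
        also have "\<dots> = 4 * (b - q)"
          unfolding D2 by (simp add: power2_eq_square algebra_simps)
        finally show ?thesis .
      qed
      then show ?thesis by simp
    qed
    then show "\<forall>t. (t - 1) * (t - b) - q = (t - (1 + b - D) / 2) * (t - (1 + b + D) / 2)"
      by (simp add: field_simps)
  qed (use D \<open>D < 1 + b\<close> in \<open>auto simp: field_simps\<close>)
qed

section \<open>Appending a column to a subunitary matrix\<close>

locale subunitary_and_vector =
  fixes m n :: nat and Q :: "complex mat" and z :: "complex vec"
  assumes n: "1 \<le> n"
    and Q: "Q \<in> carrier_mat m n" and subunitary: "subunitary Q"
    and z: "z \<in> carrier_vec m" and z_notin: "z \<notin> {Q *\<^sub>v x | x. x \<in> carrier_vec n}"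
begin

abbreviation w where "w \<equiv> mat_adjoint Q *\<^sub>v z"
abbreviation s where "s \<equiv> (euclidean_norm z)\<^sup>2"
abbreviation W where "W \<equiv> (euclidean_norm w)\<^sup>2"
abbreviation B where "B \<delta> \<equiv> append_column Q (complex_of_real \<delta> \<cdot>\<^sub>v z)"

lemma w: "w \<in> carrier_vec n"
  using mat_adjoint_carrier[OF Q] z by (rule mult_mat_vec_carrier)

lemma B: "B \<delta> \<in> carrier_mat m (Suc n)"
  using Q by (rule append_column_carrier)

lemma mat_adjoint_Q_Q: "y \<in> carrier_vec n \<Longrightarrow> mat_adjoint Q *\<^sub>v (Q *\<^sub>v y) = y"
  using subunitary Q mat_adjoint_carrier[OF Q]
  by (simp add: subunitary_def assoc_mult_mat_vec[symmetric])

lemma Q_cscalar_z: "y \<in> carrier_vec n \<Longrightarrow> (Q *\<^sub>v y) \<bullet>c z = y \<bullet>c w"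
  using cscalar_prod_mat_adjoint[OF Q _ z] .

text \<open>Pythagoras: \<open>Q w\<close> is the orthogonal projection of \<open>z\<close> onto the range of \<open>Q\<close>, and the residual
  \<open>r = z - Q w\<close> has squared norm \<open>s - W\<close>.  It does not vanish because \<open>z\<close> is outside the range.\<close>

lemma W_less_s: "W < s"
proof -
  define r where "r = z - Q *\<^sub>v w"
  have Qw: "Q *\<^sub>v w \<in> carrier_vec m" using Q w by simp
  have r: "r \<in> carrier_vec m" unfolding r_def using Qw z by simp
  have "r \<noteq> 0\<^sub>v m"
  proof
    assume "r = 0\<^sub>v m"
    then have "z = Q *\<^sub>v w"
      using z Qw by (auto simp: r_def vec_eq_iff)
    then show False using z_notin w by blast
  qed
  then have "r \<bullet>c r \<noteq> 0" using conjugate_square_eq_0_vec[OF r] by simp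
  then have nonzero: "(euclidean_norm r)\<^sup>2 \<noteq> 0" by (simp add: cscalar_prod_self)
  have "mat_adjoint Q *\<^sub>v r = w - mat_adjoint Q *\<^sub>v (Q *\<^sub>v w)"
    unfolding r_def using mat_adjoint_carrier[OF Q] z Qw by (intro mult_minus_distrib_mat_vec) auto
  also have "\<dots> = 0\<^sub>v n" using mat_adjoint_Q_Q[OF w] w by simp
  finally have "(Q *\<^sub>v w) \<bullet>c r = 0"
    using cscalar_prod_mat_adjoint[OF Q w r] w by simp
  then have "r \<bullet>c r = z \<bullet>c r"
    using z Qw r unfolding r_def by (simp add: minus_scalar_prod_distrib)
  also have "\<dots> = cnj (r \<bullet>c z)"
    using conjugate_conjugate_sprod[of "z" m "conjugate r"] conjugate_vec_sprod_comm[OF r z] z r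
    by (metis carrier_vec_conjugate conjugate_complex_def conjugate_id conjugate_conjugate_sprod)
  also have "r \<bullet>c z = z \<bullet>c z - w \<bullet>c w"
    unfolding r_def using z Qw Q_cscalar_z[OF w] by (simp add: minus_scalar_prod_distrib)
  also have "cnj \<dots> = complex_of_real (s - W)"
    by (simp add: cscalar_prod_self)
  finally have "(euclidean_norm r)\<^sup>2 = s - W"
    unfolding cscalar_prod_self of_real_eq_iff .
  then show ?thesis using nonzero zero_le_power2[of "euclidean_norm r"] by linarith
qed

lemma gram_mult_vec:
  fixes a :: complex
  assumes y: "y \<in> carrier_vec n"
  shows "(mat_adjoint (B \<delta>) * B \<delta>) *\<^sub>v snoc_vec y a =
    snoc_vec (y + (a * \<delta>) \<cdot>\<^sub>v w) (\<delta> * (y \<bullet>c w) + a * complex_of_real (\<delta>\<^sup>2 * s))"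
proof -
  have dz: "complex_of_real \<delta> \<cdot>\<^sub>v z \<in> carrier_vec m" using z by simp
  have Qy: "Q *\<^sub>v y \<in> carrier_vec m" using Q y by simp
  let ?u = "Q *\<^sub>v y + (a * \<delta>) \<cdot>\<^sub>v z"
  have u: "?u \<in> carrier_vec m" using Qy z by simp
  have "(mat_adjoint (B \<delta>) * B \<delta>) *\<^sub>v snoc_vec y a = mat_adjoint (B \<delta>) *\<^sub>v (B \<delta> *\<^sub>v snoc_vec y a)"
    by (rule assoc_mult_mat_vec[OF mat_adjoint_carrier[OF B] B snoc_vec_carrier[OF y]])
  also have "B \<delta> *\<^sub>v snoc_vec y a = ?u"
    using append_column_mult_vec[OF Q dz y] by (simp add: smult_smult_assoc)
  also have "mat_adjoint (B \<delta>) *\<^sub>v ?u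
      = snoc_vec (mat_adjoint Q *\<^sub>v ?u) (?u \<bullet>c (complex_of_real \<delta> \<cdot>\<^sub>v z))"
    by (rule mat_adjoint_append_column_mult_vec[OF Q dz u])
  also have "mat_adjoint Q *\<^sub>v ?u = y + (a * \<delta>) \<cdot>\<^sub>v w"
    using mat_adjoint_carrier[OF Q] Qy z mat_adjoint_Q_Q[OF y]
    by (simp add: mult_add_distrib_mat_vec[of _ n m] mult_mat_vec[of _ n m])
  also have "?u \<bullet>c (complex_of_real \<delta> \<cdot>\<^sub>v z) = \<delta> * (?u \<bullet>c z)"
    using u z by (simp add: conjugate_smult_vec)
  also have "?u \<bullet>c z = y \<bullet>c w + (a * \<delta>) * s"
    using Qy z Q_cscalar_z[OF y] by (simp add: add_scalar_prod_distrib[of _ m] cscalar_prod_self)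
  also have "\<delta> * (y \<bullet>c w + (a * \<delta>) * s) = \<delta> * (y \<bullet>c w) + a * complex_of_real (\<delta>\<^sup>2 * s)"
    by (simp add: algebra_simps power2_eq_square)
  finally show ?thesis .
qed

lemma gram_eigenvalue_iff:
  "eigenvalue (mat_adjoint (B \<delta>) * B \<delta>) t \<longleftrightarrow>
    (\<exists>y\<in>carrier_vec n. \<exists>a::complex. (y \<noteq> 0\<^sub>v n \<or> a \<noteq> 0) \<and>
      y + (a * \<delta>) \<cdot>\<^sub>v w = t \<cdot>\<^sub>v y \<and> \<delta> * (y \<bullet>c w) + a * complex_of_real (\<delta>\<^sup>2 * s) = t * a)"
    (is "_ \<longleftrightarrow> ?rhs")
proof -
  let ?G = "mat_adjoint (B \<delta>) * B \<delta>"
  have dim: "dim_row ?G = Suc n" using carrier_matD(1)[OF mat_adjoint_carrier[OF B]] by simp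
  have *: "eigenvector ?G (snoc_vec y a) t \<longleftrightarrow> (y \<noteq> 0\<^sub>v n \<or> a \<noteq> 0) \<and>
      y + (a * \<delta>) \<cdot>\<^sub>v w = t \<cdot>\<^sub>v y \<and> \<delta> * (y \<bullet>c w) + a * complex_of_real (\<delta>\<^sup>2 * s) = t * a"
    if y: "y \<in> carrier_vec n" for y and a :: complex
  proof -
    have "snoc_vec y a \<in> carrier_vec (Suc n)" using y by (rule snoc_vec_carrier)
    moreover have "y + (a * \<delta>) \<cdot>\<^sub>v w \<in> carrier_vec n" "t \<cdot>\<^sub>v y \<in> carrier_vec n"
      using y w by auto
    ultimately show ?thesis
      unfolding eigenvector_def dim gram_mult_vec[OF y] zero_vec_Suc_eq_snoc smult_snoc_vec
      using y by (auto simp: snoc_vec_eq_iff)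
  qed
  show ?thesis
  proof
    assume "eigenvalue ?G t"
    then obtain v where v: "eigenvector ?G v t" by (auto simp: eigenvalue_def)
    then have "v \<in> carrier_vec (Suc n)" unfolding eigenvector_def dim by blast
    then obtain y a where y: "y \<in> carrier_vec n" and "v = snoc_vec y a"
      by (rule vec_Suc_cases)
    then show "?rhs" using v *[OF y] by blast
  next
    assume ?rhs
    then show "eigenvalue ?G t" unfolding eigenvalue_def using * by blast
  qed
qed

text \<open>The first \<open>n\<close> equations \<open>(t - 1) y = a \<delta> w\<close> determine \<open>(t - 1) (y \<bullet>c w)\<close>; substituting this into
  \<open>t - 1\<close> times the last equation leaves the quadratic multiplied by \<open>a\<close>.  If \<open>a = 0\<close>, then
  \<open>y\<close> is nonzero and the first equations give \<open>t = 1\<close>.\<close>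

lemma gram_eigenvalueD:
  fixes t :: real
  assumes "eigenvalue (mat_adjoint (B \<delta>) * B \<delta>) (complex_of_real t)"
  shows "t = 1 \<or> (t - 1) * (t - \<delta>\<^sup>2 * s) - \<delta>\<^sup>2 * W = 0"
proof -
  obtain y and a :: complex where y: "y \<in> carrier_vec n" and nz: "y \<noteq> 0\<^sub>v n \<or> a \<noteq> 0"
    and 1: "y + (a * \<delta>) \<cdot>\<^sub>v w = complex_of_real t \<cdot>\<^sub>v y"
    and 2: "\<delta> * (y \<bullet>c w) + a * complex_of_real (\<delta>\<^sup>2 * s) = complex_of_real t * a"
    using assms unfolding gram_eigenvalue_iff by blast
  show ?thesis
  proof (cases "a = 0")
    case True
    then obtain i where "i < n" "y $ i \<noteq> 0" using nz y by (auto simp: vec_eq_iff)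
    moreover have "(y + (a * \<delta>) \<cdot>\<^sub>v w) $ i = (complex_of_real t \<cdot>\<^sub>v y) $ i" using 1 by simp
    ultimately show ?thesis using True y carrier_matD(1)[OF mat_adjoint_carrier[OF Q]] by simp
  next
    case False
    have "(y + (a * \<delta>) \<cdot>\<^sub>v w) \<bullet>c w = (complex_of_real t \<cdot>\<^sub>v y) \<bullet>c w" using 1 by simp
    then have "y \<bullet>c w + a * \<delta> * W = t * (y \<bullet>c w)"
      using y w by (simp add: add_scalar_prod_distrib[of _ n] cscalar_prod_self)
    \<comment> \<open>The first \<open>n\<close> equations, tested against \<open>w\<close>.\<close>
    then have 3: "(complex_of_real t - 1) * (y \<bullet>c w) = a * \<delta> * W"
      by (simp add: algebra_simps)
    have "a * ((complex_of_real t - 1) * (complex_of_real t - complex_of_real (\<delta>\<^sup>2 * s)))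
        = (complex_of_real t - 1) * (complex_of_real t * a - a * complex_of_real (\<delta>\<^sup>2 * s))"
      by (simp only: algebra_simps)
    also have "\<dots> = \<delta> * ((complex_of_real t - 1) * (y \<bullet>c w))"
      unfolding 2[symmetric] by (simp only: add_diff_cancel_right' mult_ac)
    also have "\<dots> = a * complex_of_real (\<delta>\<^sup>2 * W)"
      unfolding 3 by (simp add: power2_eq_square)
    finally have "(complex_of_real t - 1) * (complex_of_real t - complex_of_real (\<delta>\<^sup>2 * s))
        - complex_of_real (\<delta>\<^sup>2 * W) = 0"
      using False by simp
    then have "complex_of_real ((t - 1) * (t - \<delta>\<^sup>2 * s) - \<delta>\<^sup>2 * W) = 0"
      by simp
    then show ?thesis unfolding of_real_eq_0_iff by blast
  qed
qed

text \<open>For \<open>t \<noteq> 1\<close> the vector \<open>(\<delta> w, t - 1)\<close> is an eigenvector, because the first equations then hold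
  identically and the last one is the quadratic.  If \<open>t = 1\<close> is a root, then \<open>w = 0\<close>, the Gram
  matrix is diagonal, and a unit vector among the first \<open>n\<close> (here \<open>n \<ge> 1\<close> matters) is an
  eigenvector.\<close>

lemma gram_eigenvalueI:
  fixes t :: real
  assumes "\<delta> \<noteq> 0" and root: "(t - 1) * (t - \<delta>\<^sup>2 * s) - \<delta>\<^sup>2 * W = 0"
  shows "eigenvalue (mat_adjoint (B \<delta>) * B \<delta>) (complex_of_real t)"
proof (cases "t = 1")
  case False
  let ?y = "complex_of_real \<delta> \<cdot>\<^sub>v w" and ?a = "complex_of_real (t - 1)"
  have "?y + (?a * \<delta>) \<cdot>\<^sub>v w = complex_of_real t \<cdot>\<^sub>v ?y"
    using w by (auto simp: vec_eq_iff algebra_simps)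
  moreover have "\<delta> * (?y \<bullet>c w) + ?a * complex_of_real (\<delta>\<^sup>2 * s) = complex_of_real t * ?a"
  proof -
    have "\<delta> * (\<delta> * W) + (t - 1) * (\<delta>\<^sup>2 * s) = t * (t - 1)"
      using root by (simp add: power2_eq_square algebra_simps)
    then have "complex_of_real (\<delta> * (\<delta> * W) + (t - 1) * (\<delta>\<^sup>2 * s)) = complex_of_real (t * (t - 1))"
      by (rule arg_cong)
    then show ?thesis using w by (simp add: cscalar_prod_self)
  qed
  ultimately show ?thesis
    unfolding gram_eigenvalue_iff using w False
    by (intro bexI[of _ ?y] exI[of _ ?a]) auto
next
  case True
  then have "w \<bullet>c w = 0" using assms by (simp add: cscalar_prod_self)
  then have w0: "w = 0\<^sub>v n" using conjugate_square_eq_0_vec[OF w] by simp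
  show ?thesis
    unfolding gram_eigenvalue_iff True w0 using n
    by (intro bexI[of _ "unit_vec n 0"] exI[of _ 0]) auto
qed

text \<open>For \<open>\<delta> \<noteq> 0\<close>, a kernel vector with nonzero last coordinate would exhibit \<open>z\<close> as an element of
  the range of \<open>Q\<close>, and one with zero last coordinate lies in the kernel of the injective \<open>Q\<close>.\<close>

lemma full_column_rank_B_iff: "full_column_rank (B \<delta>) \<longleftrightarrow> \<delta> \<noteq> 0"
proof
  have dz: "complex_of_real \<delta> \<cdot>\<^sub>v z \<in> carrier_vec m" using z by simp
  {
    assume "full_column_rank (B \<delta>)"
    then have inj: "\<forall>v\<in>carrier_vec (Suc n). B \<delta> *\<^sub>v v = 0\<^sub>v m \<longrightarrow> v = 0\<^sub>v (Suc n)"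
      unfolding full_column_rank_iff_injective[OF B] .
    have v: "snoc_vec (0\<^sub>v n) 1 \<in> carrier_vec (Suc n)" by (intro snoc_vec_carrier) simp
    have "snoc_vec (0\<^sub>v n) 1 \<noteq> (0\<^sub>v (Suc n) :: complex vec)"
      unfolding zero_vec_Suc_eq_snoc snoc_vec_eq_iff[OF zero_carrier_vec zero_carrier_vec] by simp
    then have "B \<delta> *\<^sub>v snoc_vec (0\<^sub>v n) 1 \<noteq> 0\<^sub>v m" using inj v by blast
    then show "\<delta> \<noteq> 0"
      using append_column_mult_vec[OF Q dz, of "0\<^sub>v n" 1] Q z by (auto simp: vec_eq_iff)
  }
  assume d: "\<delta> \<noteq> 0"
  show "full_column_rank (B \<delta>)"
    unfolding full_column_rank_iff_injective[OF B]
  proof (intro ballI impI)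
    fix v assume v: "v \<in> carrier_vec (Suc n)" and Bv: "B \<delta> *\<^sub>v v = 0\<^sub>v m"
    obtain y a where y: "y \<in> carrier_vec n" and v_eq: "v = snoc_vec y a"
      using v by (rule vec_Suc_cases)
    have eq: "Q *\<^sub>v y + (a * \<delta>) \<cdot>\<^sub>v z = 0\<^sub>v m"
      using append_column_mult_vec[OF Q dz y, of a] Bv v_eq by (simp add: smult_smult_assoc)
    have "a = 0"
    proof (rule ccontr)
      assume "a \<noteq> 0"
      define c where "c = - 1 / (a * \<delta>)"
      have "Q *\<^sub>v (c \<cdot>\<^sub>v y) = c \<cdot>\<^sub>v (Q *\<^sub>v y)" using Q y by (rule mult_mat_vec)
      also have "\<dots> = z"
      proof (rule eq_vecI)
        fix i assume "i < dim_vec z"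
        then have i: "i < m" using z by simp
        have "(Q *\<^sub>v y + (a * \<delta>) \<cdot>\<^sub>v z) $ i = 0" using eq i by simp
        then have "(Q *\<^sub>v y) $ i = - (a * \<delta>) * z $ i"
          using i z Q by (simp add: add_eq_0_iff2)
        then have "c * (Q *\<^sub>v y) $ i = z $ i"
          using \<open>a \<noteq> 0\<close> d by (simp add: c_def)
        then show "(c \<cdot>\<^sub>v (Q *\<^sub>v y)) $ i = z $ i" using i Q by simp
      qed (use Q z in auto)
      finally show False using z_notin y by force
    qed
    then have "Q *\<^sub>v y = 0\<^sub>v m" using eq Q y z by (auto simp: vec_eq_iff)
    then have "y = 0\<^sub>v n" using mat_adjoint_Q_Q[OF y] mat_adjoint_carrier[OF Q] by auto
    then show "v = 0\<^sub>v (Suc n)" using \<open>a = 0\<close> v_eq zero_vec_Suc_eq_snoc by metis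
  qed
qed

lemma cond2_B:
  assumes "\<delta> \<noteq> 0"
  obtains l u where "0 < l" "l \<le> u" "l + u = 1 + \<delta>\<^sup>2 * s" "l * u = \<delta>\<^sup>2 * (s - W)"
    "cond2 (B \<delta>) = ereal (sqrt (u / l))"
proof -
  have "0 \<le> \<delta>\<^sup>2 * W" "\<delta>\<^sup>2 * W < \<delta>\<^sup>2 * s" using assms W_less_s by simp_all
  then obtain l u where lu: "0 < l" "l \<le> 1" "1 \<le> u" "l + u = 1 + \<delta>\<^sup>2 * s"
      "l * u = \<delta>\<^sup>2 * s - \<delta>\<^sup>2 * W"
    and roots: "\<forall>t. (t - 1) * (t - \<delta>\<^sup>2 * s) - \<delta>\<^sup>2 * W = (t - l) * (t - u)"
    by (rule quadratic_roots)
  let ?S = "singular_values (B \<delta>)"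
  have "{sqrt l, sqrt u} \<subseteq> ?S"
    using lu gram_eigenvalueI[OF assms] by (simp add: singular_values_def roots[rule_format] del: of_real_power)
  moreover have "?S \<subseteq> {sqrt l, 1, sqrt u}"
  proof
    fix \<sigma> assume "\<sigma> \<in> ?S"
    then have "0 \<le> \<sigma>" "\<sigma>\<^sup>2 = 1 \<or> \<sigma>\<^sup>2 = l \<or> \<sigma>\<^sup>2 = u"
      using gram_eigenvalueD[of \<delta> "\<sigma>\<^sup>2"] unfolding roots[rule_format] by (auto simp: singular_values_def)
    then have "\<sigma> = sqrt 1 \<or> \<sigma> = sqrt l \<or> \<sigma> = sqrt u"
      using real_sqrt_unique by metis
    then show "\<sigma> \<in> {sqrt l, 1, sqrt u}" by auto
  qed
  ultimately have "Max ?S = sqrt u" "Min ?S = sqrt l"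
    using Max_Min_sandwich[of "sqrt l" "sqrt u" ?S 1] lu by auto
  then have "cond2 (B \<delta>) = ereal (sqrt (u / l))"
    using assms by (simp add: cond2_def full_column_rank_B_iff real_sqrt_divide)
  then show ?thesis using that[of l u] lu by (simp add: algebra_simps)
qed

end

theorem corollary3p5:
  fixes m n :: nat and Q :: "complex mat" and z :: "complex vec"
  assumes "1 \<le> n" and "n < m"
    and "Q \<in> carrier_mat m n" and "subunitary Q"
    and "z \<in> carrier_vec m" and "z \<notin> {Q *\<^sub>v x | x. x \<in> carrier_vec n}"
  shows "\<forall>\<delta>::real.
    cond2 (append_column Q (complex_of_real (1 / euclidean_norm z) \<cdot>\<^sub>v z))
      \<le> cond2 (append_column Q (complex_of_real \<delta> \<cdot>\<^sub>v z))"
proof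
  interpret subunitary_and_vector m n Q z
    using assms by unfold_locales
  fix \<delta> :: real
  have s: "s > 0" using W_less_s zero_le_power2 by (rule le_less_trans[rotated])
  define \<delta>' where "\<delta>' = 1 / euclidean_norm z"
  have "\<delta>' \<noteq> 0" and d's: "\<delta>'\<^sup>2 * s = 1" using s by (auto simp: \<delta>'_def field_simps)
  obtain l' u' where opt: "0 < l'" "l' \<le> u'" "l' + u' = 1 + \<delta>'\<^sup>2 * s" "l' * u' = \<delta>'\<^sup>2 * (s - W)"
    and cond': "cond2 (B \<delta>') = ereal (sqrt (u' / l'))"
    using cond2_B[OF \<open>\<delta>' \<noteq> 0\<close>] by blast
  show "cond2 (B (1 / euclidean_norm z)) \<le> cond2 (B \<delta>)"
  proof (cases "\<delta> = 0")
    case True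
    then have "cond2 (B \<delta>) = \<infinity>" unfolding cond2_def full_column_rank_B_iff by simp
    then show ?thesis by simp
  next
    case False
    then obtain l u where lu: "0 < l" "l \<le> u" "l + u = 1 + \<delta>\<^sup>2 * s" "l * u = \<delta>\<^sup>2 * (s - W)"
      and cond: "cond2 (B \<delta>) = ereal (sqrt (u / l))"
      using cond2_B by blast
    have "(l' + u')\<^sup>2 * (l * u) = \<delta>'\<^sup>2 * (s - W) * (4 * (\<delta>\<^sup>2 * s))"
    proof -
      have "(l' + u')\<^sup>2 * (l * u) = 1 * (4 * (\<delta>\<^sup>2 * (s - W)))"
        unfolding opt lu d's by simp
      also have "\<dots> = (\<delta>'\<^sup>2 * s) * (4 * (\<delta>\<^sup>2 * (s - W)))"
        unfolding d's ..
      also have "\<dots> = \<delta>'\<^sup>2 * (s - W) * (4 * (\<delta>\<^sup>2 * s))"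
        by (simp only: mult_ac)
      finally show ?thesis .
    qed
    \<comment> \<open>The inequality \<open>4 x \<le> (1 + x)\<^sup>2\<close> for \<open>x = \<delta>\<^sup>2 s\<close>.\<close>
    also have "\<dots> \<le> \<delta>'\<^sup>2 * (s - W) * (1 + \<delta>\<^sup>2 * s)\<^sup>2"
    proof (rule mult_left_mono)
      have "0 \<le> (1 - \<delta>\<^sup>2 * s)\<^sup>2" by simp
      then show "4 * (\<delta>\<^sup>2 * s) \<le> (1 + \<delta>\<^sup>2 * s)\<^sup>2"
        by (simp add: power2_eq_square algebra_simps)
    qed (use W_less_s in auto)
    also have "\<dots> = (l + u)\<^sup>2 * (l' * u')"
      unfolding opt lu by simp
    finally have "u' / l' \<le> u / l"
      using opt lu by (intro quotient_le_of_sum_product) auto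
    then show ?thesis using cond cond' by (simp add: \<delta>'_def)
  qed
qed

end
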